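(* Let $a>0$, $c>0$ and $\mu<-|\sigma|$ (so that $(\mu,\sigma)\in\Sigma_\Delta=\{(\mu,\sigma):|\sigma|<-\mu\}$). Let $M_0=-\frac{a}{c}$, $N_0=\frac{a\sigma}{c\mu}$ and $\tau=a+cN$, where $N$ and the initial function $\varphi$ satisfy the following. (i) If $\sigma>0$, let $N\geq 0$ and suppose that $\varphi(t)\in[M_0,N]$ for $t\in[-\tau,0]$ and $\varphi$ is continuous on $[-\tau,0]$. (ii) If $\sigma\leq 0$, let $N=\max\{\varphi(0),N_0\}$ and suppose that $\varphi(t)\geq M_0$ for $t\in[-\tau,0]$ and $\varphi$ is continuous on $[-\tau,0]$. Then any solution $u(t)$ of $$\dot u(t)=\mu u(t)+\sigma u(t-a-cu(t)),\quad t>0,\qquad u(t)=\varphi(t),\quad t\leq 0,$$ satisfies $u(t)\in(M_0,N)$ for all $t>0$, and $u(t)\to0$ as $t\to\infty$.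
   Context: The equation is a scalar state-dependent delay differential equation with initial function $\varphi$. A solution is a function $u$ with $u(t)=\varphi(t)$ for $t\leq0$, whose restriction to $[0,\infty)$ is $C^1$, and which satisfies the differential equation for all $t>0$.
   Formalization: If φ(0)=N and μN+σφ=0 on an interval just right of −τ (e.g. N=0, φ=0), the bound u<N fails, so there only u∈(M_0,N] is claimed; continuity of φ on [−τ,0] is read as continuity at each point for φ on (−∞,0], also from the left at −τ. *)

theory Defs
  imports "HOL-Analysis.Analysis"
begin

definition Sigma_Delta :: "(real \<times> real) set" where
  "Sigma_Delta = {(\<mu>, \<sigma>). \<bar>\<sigma>\<bar> < - \<mu>}"

text \<open>
  The derivative at the left end point 0 is one-sided, since a solution is in general not
  differentiable at 0 as a function on the whole line.
\<close>
definition C1_on_nonneg :: "(real \<Rightarrow> real) \<Rightarrow> bool" where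
  "C1_on_nonneg u \<longleftrightarrow>
     (\<exists>u'. continuous_on {0..} u' \<and>
           (\<forall>t\<ge>0. (u has_real_derivative u' t) (at t within {0..})))"

text \<open>Only the values of \<open>\<phi>\<close> on the nonpositive half-line matter.\<close>
definition sdde_solution ::
  "real \<Rightarrow> real \<Rightarrow> real \<Rightarrow> real \<Rightarrow> (real \<Rightarrow> real) \<Rightarrow> (real \<Rightarrow> real) \<Rightarrow> bool" where
  "sdde_solution a c \<mu> \<sigma> \<phi> u \<longleftrightarrow>
     (\<forall>t\<le>0. u t = \<phi> t) \<and>
     C1_on_nonneg u \<and>
     (\<forall>t>0. (u has_real_derivative (\<mu> * u t + \<sigma> * u (t - a - c * u t))) (at t))"

text \<open>
  Continuity on \<open>[-\<tau>, 0]\<close> means continuity at every point of that interval of \<open>\<phi>\<close> as a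
  function on its domain, the nonpositive half-line. At \<open>-\<tau>\<close> this is two-sided, unlike
  \<open>continuous_on {-\<tau>..0} \<phi>\<close>: otherwise values of \<open>\<phi>\<close> below \<open>-\<tau>\<close>, which are not
  constrained at all, could drive a solution starting at \<open>\<phi> 0 = N\<close> above \<open>N\<close>.
\<close>
definition history_continuous :: "real \<Rightarrow> (real \<Rightarrow> real) \<Rightarrow> bool" where
  "history_continuous \<tau> \<phi> \<longleftrightarrow> (\<forall>t\<in>{-\<tau>..0}. continuous (at t within {..0}) \<phi>)"

text \<open>
  The initial data for which a solution can rest at the value \<open>N\<close> on an interval to the right
  of 0: it starts at \<open>N\<close>, and as long as it stays there its delay is \<open>a + c * N\<close> and
  the right-hand side vanishes. With \<open>a = c = 1\<close>, \<open>\<mu> = - 2\<close> these include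
  \<open>\<sigma> = 1\<close>, \<open>N = 0\<close>, \<open>\<phi> = 0\<close>, with solution \<open>u = 0\<close>, and
  \<open>\<sigma> = - 1\<close>, \<open>N = \<phi> 0 = 1/2\<close>, \<open>\<phi> = - 1\<close> on \<open>[- 3/2, - 1/2]\<close>, with
  \<open>u = 1/2\<close> on \<open>[0, 1]\<close>. For such data the upper bound \<open>N\<close> is attained at positive times.
\<close>
definition rests_at ::
  "real \<Rightarrow> real \<Rightarrow> real \<Rightarrow> real \<Rightarrow> (real \<Rightarrow> real) \<Rightarrow> real \<Rightarrow> bool" where
  "rests_at a c \<mu> \<sigma> \<phi> N \<longleftrightarrow>
     \<phi> 0 = N \<and>
     (\<exists>\<epsilon>>0. \<forall>s\<in>{- (a + c * N) .. - (a + c * N) + \<epsilon>}. \<mu> * N + \<sigma> * \<phi> s = 0)"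

end

theory Submission
  imports Defs
begin

text \<open>
  Write \<open>\<alpha>(t) = t - a - c u(t)\<close> for the time at which the delayed value is read, and
  \<open>F(t) = \<mu> u(t) + \<sigma> u(\<alpha>(t))\<close> for the right-hand side. The argument is a chain of barriers.

  The value \<open>M0 = - a / c\<close> is the one at which the delay vanishes. If \<open>u(t) = M0\<close>, then
  \<open>\<alpha>(t) = t\<close> and \<open>F(t) = (\<mu> + \<sigma>) M0 > 0\<close>, so \<open>u\<close> can only leave this level upwards. Hence
  \<open>u > M0\<close> and \<open>\<alpha>(t) < t\<close> at positive times.

  The history is controlled on \<open>[-\<tau>, 0]\<close> only, so \<open>\<alpha>\<close> must be kept above \<open>- \<tau>\<close>. This is the
  same kind of barrier: \<open>\<alpha>(t) = - \<tau>\<close> forces \<open>u(t) \<ge> N\<close>, hence \<open>F(t) \<le> 0\<close> and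
  \<open>\<alpha>'(t) = 1 - c F(t) > 0\<close>.

  The number \<open>N\<close> is chosen so that \<open>\<mu> m + \<sigma> y < 0\<close> whenever \<open>m > N\<close> and \<open>y\<close> is a delayed value
  that can occur at a running maximum \<open>m\<close>: for \<open>\<sigma> > 0\<close> since \<open>y \<le> m\<close>, \<open>m > 0\<close> and
  \<open>\<mu> + \<sigma> < 0\<close>, for \<open>\<sigma> \<le> 0\<close> since \<open>y \<ge> M0\<close>, \<open>m > N0\<close> and \<open>\<mu> N0 + \<sigma> M0 = 0\<close>. So no running
  maximum above \<open>N\<close> exists, and \<open>u \<le> N\<close>.

  With all values confined, \<open>u - N\<close> satisfies \<open>w' \<le> \<mu> w\<close>. If \<open>u\<close> attains \<open>N\<close> at a time
  \<open>t > 0\<close>, comparison with an exponential gives \<open>u = N\<close> on all of \<open>[0, t]\<close>; the equation then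
  turns this into the condition \<^const>\<open>rests_at\<close> on the initial data.

  Finally, the delay is at most \<open>\<tau>\<close>. A bound \<open>\<bar>u\<bar> \<le> K\<close> near infinity therefore bounds the
  delayed term by \<open>\<bar>\<sigma>\<bar> K\<close>, and the instantaneous damping improves the bound to any value above
  \<open>\<bar>\<sigma>\<bar> / \<bar>\<mu>\<bar> K\<close>. As \<open>\<bar>\<sigma>\<bar> / \<bar>\<mu>\<bar> < 1\<close>, iteration gives \<open>u \<longlongrightarrow> 0\<close>.
\<close>

section \<open>Comparison principles on a half-line\<close>

text \<open>
  A function that is increasing wherever it vanishes can cross zero upwards only. This also covers
  the start at \<open>f 0 = 0\<close>, which is why one-sided derivatives at 0 are used.
\<close>
lemma pos_if_increasing_at_zeros:
  fixes f f' :: "real \<Rightarrow> real"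
  assumes der: "\<And>t. t \<ge> 0 \<Longrightarrow> (f has_real_derivative f' t) (at t within {0..})"
    and start: "0 \<le> f 0"
    and up: "\<And>t. t \<ge> 0 \<Longrightarrow> f t = 0 \<Longrightarrow> 0 < f' t"
    and "t > 0"
  shows "0 < f t"
proof -
  have cont: "continuous_on {0..} f"
    using der by (auto simp: continuous_on_eq_continuous_within intro: DERIV_continuous)
  have nonneg: "0 \<le> f s" if "s \<ge> 0" for s
  proof (rule ccontr)
    assume neg: "\<not> 0 \<le> f s"
    define A where "A = {x \<in> {0..s}. 0 \<le> f x}"
    have conts: "continuous_on {0..s} f"
      by (rule continuous_on_subset[OF cont]) auto
    have "closed A"
      unfolding A_def by (intro continuous_on_closed_Collect_le conts continuous_on_const) auto
    moreover have "bounded A"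
      by (rule bounded_subset[of "{0..s}"]) (auto simp: A_def)
    ultimately have "compact A" by (simp add: compact_eq_bounded_closed)
    moreover have "0 \<in> A" using start that by (simp add: A_def)
    ultimately obtain z where z: "z \<in> A" and last: "\<And>x. x \<in> A \<Longrightarrow> x \<le> z"
      using compact_attains_sup[of A] by auto
    have z0: "0 \<le> z" "z < s" "0 \<le> f z" using z neg by (auto simp: A_def less_le)
    have "f z = 0"
    proof (rule ccontr)
      assume "f z \<noteq> 0"
      then have "0 < f z" using z0 by simp
      moreover have "continuous_on {z..s} f"
        by (rule continuous_on_subset[OF conts]) (use z0 in auto)
      ultimately obtain x where "z \<le> x" "x \<le> s" "f x = 0"
        using IVT2'[of f s 0 z] z0 neg by auto
      moreover from this have "x \<in> A" using z0 by (simp add: A_def)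
      ultimately show False using last[of x] \<open>0 < f z\<close> by auto
    qed
    then obtain d where d: "d > 0" "\<And>h. 0 < h \<Longrightarrow> z + h \<in> {0..} \<Longrightarrow> h < d \<Longrightarrow> f z < f (z + h)"
      using has_real_derivative_pos_inc_right[OF der[OF z0(1)] up] z0 by blast
    define h where "h = min d (s - z) / 2"
    have h: "0 < h" "h < d" "z + h \<le> s" using d z0 by (auto simp: h_def min_def field_simps)
    with d(2)[of h] z0 have "z + h \<in> A" by (simp add: A_def)
    then show False using last[of "z + h"] h by simp
  qed
  show ?thesis
  proof (rule ccontr)
    assume "\<not> 0 < f t"
    then have "f t = 0" using nonneg[of t] \<open>t > 0\<close> by simp
    then obtain d where d: "d > 0" "\<And>h. 0 < h \<Longrightarrow> t - h \<in> {0..} \<Longrightarrow> h < d \<Longrightarrow> f (t - h) < f t"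
      using has_real_derivative_pos_inc_left[OF der[of t] up] \<open>t > 0\<close> by (metis less_imp_le)
    define h where "h = min d t / 2"
    have "0 < h" "h < d" "h \<le> t" using d \<open>t > 0\<close> by (auto simp: h_def min_def)
    then show False using d(2)[of h] nonneg[of "t - h"] \<open>f t = 0\<close> by simp
  qed
qed

lemma exp_comparison:
  fixes w w' :: "real \<Rightarrow> real"
  assumes "p \<le> q" and cont: "continuous_on {p..q} w"
    and der: "\<And>t. p < t \<Longrightarrow> t < q \<Longrightarrow> (w has_real_derivative w' t) (at t)"
    and le: "\<And>t. p < t \<Longrightarrow> t < q \<Longrightarrow> w' t \<le> k * w t"
  shows "w q \<le> w p * exp (k * (q - p))"
proof -
  have "w q * exp (- k * q) \<le> w p * exp (- k * p)"
  proof (rule DERIV_nonpos_imp_decreasing_open[OF \<open>p \<le> q\<close>, of "\<lambda>t. w t * exp (- k * t)"])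
    fix t assume t: "p < t" "t < q"
    have "((\<lambda>t. w t * exp (- k * t)) has_real_derivative (w' t - k * w t) * exp (- k * t)) (at t)"
      by (rule derivative_eq_intros der[OF t] refl | simp add: algebra_simps)+
    moreover have "(w' t - k * w t) * exp (- k * t) \<le> 0"
      using le[OF t] by (simp add: mult_nonpos_nonneg)
    ultimately show "\<exists>y. ((\<lambda>t. w t * exp (- k * t)) has_real_derivative y) (at t) \<and> y \<le> 0"
      by blast
  next
    show "continuous_on {p..q} (\<lambda>t. w t * exp (- k * t))"
      by (intro continuous_intros cont)
  qed
  then have "w q * exp (- k * q) * exp (k * q) \<le> w p * exp (- k * p) * exp (k * q)"
    by (intro mult_right_mono) auto
  then show ?thesis
    by (simp add: mult.assoc flip: exp_add) (simp add: algebra_simps)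
qed

lemma eventually_le_if_damped:
  fixes w w' :: "real \<Rightarrow> real"
  assumes "k < 0" "e > 0"
    and der: "\<And>t. t > S \<Longrightarrow> (w has_real_derivative w' t) (at t)"
    and le: "\<And>t. t > S \<Longrightarrow> w' t \<le> k * w t"
  shows "eventually (\<lambda>t. w t \<le> e) at_top"
proof -
  define p where "p = S + 1"
  have "filterlim (\<lambda>t. - k * (t - p)) at_top at_top"
    using \<open>k < 0\<close> by (intro filterlim_tendsto_pos_mult_at_top[OF tendsto_const]
        filterlim_tendsto_add_at_top[of "\<lambda>_. - p" "- p", simplified] filterlim_ident) auto
  then have "filterlim (\<lambda>t. k * (t - p)) at_bot at_top"
    by (simp add: filterlim_uminus_at_bot)
  then have "((\<lambda>t. exp (k * (t - p))) \<longlongrightarrow> 0) at_top"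
    by (rule filterlim_compose[OF exp_at_bot])
  then have "((\<lambda>t. w p * exp (k * (t - p))) \<longlongrightarrow> 0) at_top"
    by (rule tendsto_mult_right_zero)
  then have "eventually (\<lambda>t. w p * exp (k * (t - p)) < e) at_top"
    using \<open>e > 0\<close> by (rule order_tendstoD)
  then show ?thesis
    using eventually_ge_at_top[of p]
  proof eventually_elim
    case (elim t)
    have "w t \<le> w p * exp (k * (t - p))"
    proof (rule exp_comparison[where w' = w'])
      show "continuous_on {p..t} w"
        by (rule DERIV_continuous_on[of _ _ w'])
          (auto simp: p_def intro!: has_field_derivative_at_within[OF der])
    qed (use elim in \<open>auto simp: p_def intro!: der le\<close>)
    then show ?case using elim by simp
  qed
qed

section \<open>Solutions with admissible initial data\<close>

text \<open>
  The hypotheses on \<open>N\<close> and on the history that the cases \<open>\<sigma> > 0\<close> and \<open>\<sigma> \<le> 0\<close> have in common,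
  so that both can be treated by the same argument.
\<close>
locale admissible_solution =
  fixes a c \<mu> \<sigma> N :: real and \<phi> u :: "real \<Rightarrow> real"
  assumes a_pos: "a > 0" and c_pos: "c > 0" and damped: "\<bar>\<sigma>\<bar> < - \<mu>"
    and N_nonneg: "N \<ge> 0"
    and N_ge: "\<sigma> \<le> 0 \<Longrightarrow> (a * \<sigma>) / (c * \<mu>) \<le> N"
    and start_le: "\<phi> 0 \<le> N"
    and hist_ge: "\<And>t. - (a + c * N) \<le> t \<Longrightarrow> t \<le> 0 \<Longrightarrow> - (a / c) \<le> \<phi> t"
    and hist_le: "\<And>t. - (a + c * N) \<le> t \<Longrightarrow> t \<le> 0 \<Longrightarrow> \<sigma> > 0 \<Longrightarrow> \<phi> t \<le> N"
    and hist_cont: "history_continuous (a + c * N) \<phi>"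
    and solution: "sdde_solution a c \<mu> \<sigma> \<phi> u"
begin

abbreviation \<tau> where "\<tau> \<equiv> a + c * N"

definition \<alpha> where "\<alpha> t = t - a - c * u t"

definition F where "F t = \<mu> * u t + \<sigma> * u (\<alpha> t)"

lemma \<mu>_neg: "\<mu> < 0"
  using damped by simp

lemma \<tau>_pos: "\<tau> > 0"
  using a_pos c_pos N_nonneg by (simp add: add_pos_nonneg)

lemma u_history: "t \<le> 0 \<Longrightarrow> u t = \<phi> t"
  using solution by (simp add: sdde_solution_def)

lemma start_ge: "- (a / c) \<le> u 0"
  using hist_ge[of 0] \<tau>_pos u_history[of 0] by simp

lemma isCont_u:
  assumes "- \<tau> \<le> t"
  shows "isCont u t"
proof -
  have left: "continuous (at t within {..0}) u" if "t \<le> 0"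
  proof -
    have "continuous (at t within {..0}) \<phi>"
      using hist_cont that assms by (simp add: history_continuous_def)
    then show ?thesis
      by (rule continuous_transform_within[where \<delta> = 1]) (use that u_history in auto)
  qed
  have right: "continuous (at t within {0..}) u" if "t \<ge> 0"
    using solution that by (auto simp: sdde_solution_def C1_on_nonneg_def intro: DERIV_continuous)
  consider "t < 0" | "t = 0" | "t > 0" by linarith
  then show ?thesis
  proof cases
    case 1
    then show ?thesis using left at_within_interior[of t "{..0}"] by simp
  next
    case 2
    then have "continuous (at t within {..0} \<union> {0..}) u"
      using left right by (auto simp: continuous_within intro: Lim_Un)
    moreover have "{..0} \<union> {0..} = (UNIV :: real set)" by auto
    ultimately show ?thesis by simp
  next
    case 3
    then show ?thesis using right at_within_interior[of t "{0..}"] by simp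
  qed
qed

text \<open>
  At 0 the equation is not assumed, but it holds with the one-sided derivative: the derivative is
  continuous on the closed half-line, and \<open>F\<close> is continuous at 0, because \<open>\<alpha> 0\<close> lies in the interval where the
  history is continuous.
\<close>
lemma has_derivative_F:
  assumes "t \<ge> 0"
  shows "(u has_real_derivative F t) (at t within {0..})"
proof (cases "t = 0")
  case False
  then have "(u has_real_derivative F t) (at t)"
    using solution assms unfolding sdde_solution_def F_def \<alpha>_def by simp
  then show ?thesis by (rule has_field_derivative_at_within)
next
  case True
  obtain u' where u': "continuous_on {0..} u'"
      "\<And>t. t \<ge> 0 \<Longrightarrow> (u has_real_derivative u' t) (at t within {0..})"
    using solution by (auto simp: sdde_solution_def C1_on_nonneg_def)
  have eq: "u' s = F s" if "s > 0" for s
  proof -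
    have "(u has_real_derivative u' s) (at s)"
      using u'(2)[of s] that at_within_interior[of s "{0..}"] by simp
    moreover have "(u has_real_derivative F s) (at s)"
      using solution that by (simp add: sdde_solution_def F_def \<alpha>_def)
    ultimately show ?thesis by (rule DERIV_unique)
  qed
  have "c * u 0 \<le> c * N" using start_le u_history[of 0] c_pos by simp
  then have "isCont u (\<alpha> 0)" by (intro isCont_u) (simp add: \<alpha>_def)
  moreover have u0: "isCont u 0" using \<tau>_pos by (intro isCont_u) simp
  moreover have "isCont \<alpha> 0" unfolding \<alpha>_def by (intro continuous_intros u0)
  ultimately have "isCont (\<lambda>t. u (\<alpha> t)) 0" using isCont_o2[of 0 \<alpha> u] by blast
  then have "isCont F 0" unfolding F_def by (intro continuous_intros u0)
  then have "(F \<longlongrightarrow> F 0) (at_right 0)"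
    by (simp add: isCont_def filterlim_at_split)
  moreover have "(u' \<longlongrightarrow> u' 0) (at_right 0)"
    using u'(1) by (auto simp: continuous_on_def intro: tendsto_within_subset)
  then have "(F \<longlongrightarrow> u' 0) (at_right 0)"
    by (rule Lim_transform_eventually)
      (use eq in \<open>auto simp: eventually_at_filter\<close>)
  ultimately have "F 0 = u' 0" by (intro tendsto_unique[of "at_right 0"]) auto
  then show ?thesis using u'(2)[of 0] True by simp
qed

lemma has_derivative_F_pos:
  assumes "t > 0"
  shows "(u has_real_derivative F t) (at t)"
  using has_derivative_F[of t] assms at_within_interior[of t "{0..}"] by simp

section \<open>The invariant strip\<close>

lemma above_lower_barrier:
  assumes "t > 0"
  shows "- (a / c) < u t"
proof -
  have "0 < u t + a / c"
  proof (rule pos_if_increasing_at_zeros[where f = "\<lambda>t. u t + a / c" and f' = F])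
    fix s :: real assume s: "s \<ge> 0"
    show "((\<lambda>t. u t + a / c) has_real_derivative F s) (at s within {0..})"
      using DERIV_add[OF has_derivative_F[OF s] DERIV_const[of "a / c"]] by simp
    assume "u s + a / c = 0"
    then have us: "u s = - (a / c)" by simp
    then have "\<alpha> s = s" using c_pos by (simp add: \<alpha>_def)
    then have "F s = (\<mu> + \<sigma>) * - (a / c)" by (simp only: F_def us distrib_right)
    also have "\<dots> > 0" using damped a_pos c_pos by (intro mult_neg_neg) auto
    finally show "0 < F s" .
  qed (use start_ge assms in auto)
  then show ?thesis by simp
qed

lemma u_ge: "- \<tau> \<le> t \<Longrightarrow> - (a / c) \<le> u t"
  using above_lower_barrier[of t] hist_ge[of t] u_history[of t] by (cases "t > 0") auto

lemma \<alpha>_less: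
  assumes "t > 0"
  shows "\<alpha> t < t"
proof -
  have "c * - (a / c) < c * u t"
    using above_lower_barrier[OF assms] c_pos by (intro mult_strict_left_mono)
  then show ?thesis using c_pos by (simp add: \<alpha>_def)
qed

text \<open>
  The defining property of \<open>N\<close>. For \<open>\<sigma> \<le> 0\<close> it rests on \<open>\<mu> N0 + \<sigma> M0 = 0\<close>, which is where
  \<open>N0 = a \<sigma> / (c \<mu>)\<close> comes from.
\<close>
lemma rhs_at_upper_level:
  assumes "N \<le> m" "- (a / c) \<le> y" "\<sigma> > 0 \<Longrightarrow> y \<le> m"
  shows "\<mu> * m + \<sigma> * y \<le> 0"
    and "N < m \<Longrightarrow> \<mu> * m + \<sigma> * y < 0"
proof -
  have "\<mu> * m + \<sigma> * y \<le> 0 \<and> (N < m \<longrightarrow> \<mu> * m + \<sigma> * y < 0)"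
  proof (cases "\<sigma> > 0")
    case True
    then have "\<mu> * m + \<sigma> * y \<le> (\<mu> + \<sigma>) * m"
      using assms(3) by (simp add: algebra_simps)
    moreover have "(\<mu> + \<sigma>) * m \<le> 0"
      using damped assms(1) N_nonneg by (intro mult_nonpos_nonneg) auto
    moreover have "(\<mu> + \<sigma>) * m < 0" if "N < m"
      using damped that N_nonneg by (intro mult_neg_pos) auto
    ultimately show ?thesis by auto
  next
    case False
    then have "\<sigma> * y \<le> \<sigma> * - (a / c)"
      using assms(2) by (intro mult_left_mono_neg) auto
    also have "\<dots> = - \<mu> * ((a * \<sigma>) / (c * \<mu>))"
      using \<mu>_neg c_pos by (simp add: field_simps)
    also have "\<dots> \<le> - \<mu> * N"
      using N_ge False \<mu>_neg by (intro mult_left_mono) auto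
    finally have y: "\<sigma> * y \<le> - \<mu> * N" .
    have "\<mu> * m \<le> \<mu> * N" "N < m \<Longrightarrow> \<mu> * m < \<mu> * N"
      using \<mu>_neg assms(1) by auto
    with y show ?thesis by auto
  qed
  then show "\<mu> * m + \<sigma> * y \<le> 0" "N < m \<Longrightarrow> \<mu> * m + \<sigma> * y < 0" by auto
qed

text \<open>
  The delayed time cannot reach the uncontrolled part of the history: where \<open>\<alpha> t = - \<tau>\<close>, the value
  \<open>u t = N + t / c\<close> is so high that \<open>u\<close> cannot increase, and then \<open>\<alpha>\<close> increases. The upper
  bound on \<open>u\<close> relies on this, because its proof reads the delayed value at a running maximum.
\<close>
lemma \<alpha>_greater:
  assumes "t > 0"
  shows "- \<tau> < \<alpha> t"
proof -
  have "0 < \<alpha> t + \<tau>"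
  proof (rule pos_if_increasing_at_zeros[where f = "\<lambda>t. \<alpha> t + \<tau>" and f' = "\<lambda>t. 1 - c * F t"])
    fix s :: real assume s: "s \<ge> 0"
    show "((\<lambda>t. \<alpha> t + \<tau>) has_real_derivative 1 - c * F s) (at s within {0..})"
      unfolding \<alpha>_def
      by (rule derivative_eq_intros has_derivative_F[OF s] refl | simp)+
    assume "\<alpha> s + \<tau> = 0"
    then have \<alpha>s: "\<alpha> s = - \<tau>" by simp
    then have "c * (u s - N) = s" by (simp add: \<alpha>_def algebra_simps)
    then have "N \<le> u s" using s c_pos by (metis diff_ge_0_iff_ge zero_le_mult_iff not_less)
    have "u (- \<tau>) = \<phi> (- \<tau>)" using u_history \<tau>_pos by simp
    then have "\<mu> * N + \<sigma> * u (- \<tau>) \<le> 0"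
      using hist_ge[of "- \<tau>"] hist_le[of "- \<tau>"] \<tau>_pos
      by (intro rhs_at_upper_level) auto
    moreover have "\<mu> * u s \<le> \<mu> * N" using \<open>N \<le> u s\<close> \<mu>_neg by simp
    ultimately have "F s \<le> 0" by (simp add: F_def \<alpha>s)
    then have "c * F s \<le> 0" using c_pos by (simp add: mult_nonneg_nonpos)
    then show "0 < 1 - c * F s" by simp
  qed (use assms start_le u_history[of 0] c_pos in \<open>auto simp: \<alpha>_def\<close>)
  then show ?thesis by simp
qed

lemma u_le:
  assumes "t \<ge> 0"
  shows "u t \<le> N"
proof (rule ccontr)
  assume above: "\<not> u t \<le> N"
  have "continuous_on {0..t} u"
    using isCont_u \<tau>_pos by (intro continuous_at_imp_continuous_on) auto
  then obtain m where m: "0 \<le> m" "m \<le> t" and max: "\<And>s. 0 \<le> s \<Longrightarrow> s \<le> t \<Longrightarrow> u s \<le> u m"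
    using continuous_attains_sup[of "{0..t}" u] assms by auto
  have "N < u m" using max[of t] above assms by simp
  then have "m > 0" using m start_le u_history[of 0] by (cases "m = 0") auto
  have "u (\<alpha> m) \<le> u m" if "\<sigma> > 0"
  proof (cases "\<alpha> m \<ge> 0")
    case True
    then show ?thesis using max \<alpha>_less[OF \<open>m > 0\<close>] m by simp
  next
    case False
    then show ?thesis
      using hist_le[of "\<alpha> m"] \<alpha>_greater[OF \<open>m > 0\<close>] that u_history \<open>N < u m\<close> by simp
  qed
  then have "F m < 0"
    unfolding F_def using \<open>N < u m\<close> u_ge[of "\<alpha> m"] \<alpha>_greater[OF \<open>m > 0\<close>]
    by (intro rhs_at_upper_level) auto
  then obtain d where d: "d > 0" "\<And>h. 0 < h \<Longrightarrow> h < d \<Longrightarrow> u m < u (m - h)"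
    using DERIV_neg_dec_left[OF has_derivative_F_pos[OF \<open>m > 0\<close>]] by blast
  define h where "h = min d m / 2"
  have "0 < h" "h < d" "h \<le> m" using d \<open>m > 0\<close> by (auto simp: h_def min_def)
  then show False using d(2)[of h] max[of "m - h"] m by simp
qed

lemma \<alpha>_ge:
  assumes "t \<ge> 0"
  shows "t - \<tau> \<le> \<alpha> t"
  using u_le[OF assms] c_pos by (simp add: \<alpha>_def)

section \<open>Attaining the upper bound\<close>

lemma F_le:
  assumes "t > 0"
  shows "F t \<le> \<mu> * (u t - N)"
proof -
  have "u (\<alpha> t) \<le> N" if "\<sigma> > 0"
    using hist_le[of "\<alpha> t"] u_le[of "\<alpha> t"] u_history[of "\<alpha> t"] \<alpha>_greater[OF assms] that
    by (cases "\<alpha> t \<ge> 0") auto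
  then have "\<mu> * N + \<sigma> * u (\<alpha> t) \<le> 0"
    using u_ge[of "\<alpha> t"] \<alpha>_greater[OF assms] by (intro rhs_at_upper_level) auto
  then show ?thesis by (simp add: F_def algebra_simps)
qed

text \<open>
  Below \<open>N\<close> the gap \<open>N - u\<close> can shrink at most exponentially, so it cannot close in finite time. A
  solution that touches \<open>N\<close> has therefore been there from the start.
\<close>
lemma rests_at_if_attained:
  assumes "t > 0" "u t = N"
  shows "rests_at a c \<mu> \<sigma> \<phi> N"
proof -
  have rest: "u s = N" if "0 \<le> s" "s \<le> t" for s
  proof -
    have "u t - N \<le> (u s - N) * exp (\<mu> * (t - s))"
    proof (rule exp_comparison[where w' = F])
      show "continuous_on {s..t} (\<lambda>x. u x - N)"
        using \<tau>_pos that
        by (intro continuous_intros continuous_at_imp_continuous_on ballI isCont_u) simp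
      fix x assume "s < x" "x < t"
      then have "x > 0" using that by simp
      show "((\<lambda>x. u x - N) has_real_derivative F x) (at x)"
        using DERIV_diff[OF has_derivative_F_pos[OF \<open>x > 0\<close>] DERIV_const[of N]] by simp
      show "F x \<le> \<mu> * (u x - N)" using F_le \<open>x > 0\<close> by simp
    qed (use that in auto)
    then have "N \<le> u s" using assms(2) by (simp add: zero_le_mult_iff)
    then show ?thesis using u_le that by (intro antisym) auto
  qed
  have F0: "F s = 0" if "0 \<le> s" "s < t" for s
  proof -
    have "((\<lambda>_. N) has_real_derivative F s) (at s within {0..t})"
      using rest that
      by (intro has_field_derivative_transform_within[OF
            DERIV_subset[OF has_derivative_F[OF that(1)]], of "{0..t}" 1]) auto
    moreover have "((\<lambda>_. N) has_real_derivative 0) (at s within {0..t})" by simp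
    moreover have "at s within {0..t} \<noteq> bot"
      using that by (simp add: trivial_limit_within islimpt_Icc)
    ultimately show ?thesis using has_field_derivative_unique by blast
  qed
  have "0 < min t \<tau>" using assms(1) \<tau>_pos by simp
  then obtain e where e: "0 < e" "e < min t \<tau>" using dense by blast
  have "\<mu> * N + \<sigma> * \<phi> x = 0" if "x \<in> {- \<tau> .. - \<tau> + e}" for x
  proof -
    have "F (x + \<tau>) = 0" "u (x + \<tau>) = N" using that e F0[of "x + \<tau>"] rest[of "x + \<tau>"] by auto
    moreover from this have "\<alpha> (x + \<tau>) = x" by (simp add: \<alpha>_def)
    moreover have "u x = \<phi> x" using that e by (intro u_history) simp
    ultimately show ?thesis by (simp add: F_def)
  qed
  moreover have "\<phi> 0 = N" using rest[of 0] assms u_history[of 0] by simp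
  ultimately show ?thesis unfolding rests_at_def using \<open>0 < e\<close> by blast
qed

section \<open>Convergence to zero\<close>

text \<open>
  The limiting bound is \<open>L K\<close> with \<open>L = \<bar>\<sigma>\<bar> / (- \<mu>) < 1\<close>; the midpoint of \<open>L\<close> and 1 leaves room for
  the exponentially decaying error.
\<close>
lemma eventually_bound_contracts:
  assumes "K > 0" and "eventually (\<lambda>t. \<bar>u t\<bar> \<le> K) at_top"
  shows "eventually (\<lambda>t. \<bar>u t\<bar> \<le> (1 + \<bar>\<sigma>\<bar> / - \<mu>) / 2 * K) at_top"
proof -
  define L where "L = \<bar>\<sigma>\<bar> / - \<mu>"
  have "L < 1" using damped \<mu>_neg by (simp add: L_def divide_simps)
  have \<mu>L: "\<mu> * L = - \<bar>\<sigma>\<bar>" using \<mu>_neg by (simp add: L_def)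
  define e where "e = (1 - L) / 2 * K"
  have "e > 0" using \<open>L < 1\<close> \<open>K > 0\<close> by (simp add: e_def)
  obtain T where T: "\<And>t. t \<ge> T \<Longrightarrow> \<bar>u t\<bar> \<le> K"
    using assms(2) by (auto simp: eventually_at_top_linorder)
  define S where "S = max 0 (T + \<tau>)"
  have pos: "t > 0" if "t > S" for t using that by (simp add: S_def)
  have delayed: "\<bar>\<sigma> * u (\<alpha> t)\<bar> \<le> \<bar>\<sigma>\<bar> * K" if "t > S" for t
    unfolding abs_mult using T[of "\<alpha> t"] \<alpha>_ge[of t] that
    by (intro mult_left_mono) (auto simp: S_def)
  have "eventually (\<lambda>t. u t - L * K \<le> e) at_top"
  proof (rule eventually_le_if_damped[OF \<mu>_neg \<open>e > 0\<close>, where w' = F and S = S])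
    fix t assume t: "t > S"
    show "((\<lambda>t. u t - L * K) has_real_derivative F t) (at t)"
      using DERIV_diff[OF has_derivative_F_pos[OF pos[OF t]] DERIV_const[of "L * K"]] by simp
    have "\<mu> * (u t - L * K) = \<mu> * u t + \<bar>\<sigma>\<bar> * K" by (simp add: right_diff_distrib \<mu>L flip: mult.assoc)
    then show "F t \<le> \<mu> * (u t - L * K)" using delayed[OF t] by (simp add: F_def)
  qed
  moreover have "eventually (\<lambda>t. - u t - L * K \<le> e) at_top"
  proof (rule eventually_le_if_damped[OF \<mu>_neg \<open>e > 0\<close>, where w' = "\<lambda>t. - F t" and S = S])
    fix t assume t: "t > S"
    show "((\<lambda>t. - u t - L * K) has_real_derivative - F t) (at t)"
      using DERIV_diff[OF DERIV_minus[OF has_derivative_F_pos[OF pos[OF t]]] DERIV_const[of "L * K"]]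
      by simp
    have "\<mu> * (- u t - L * K) = - \<mu> * u t + \<bar>\<sigma>\<bar> * K"
      by (simp add: right_diff_distrib \<mu>L flip: mult.assoc)
    then show "- F t \<le> \<mu> * (- u t - L * K)" using delayed[OF t] by (simp add: F_def)
  qed
  ultimately show ?thesis
  proof eventually_elim
    case (elim t)
    have "L * K + e = (1 + L) / 2 * K" by (simp add: e_def field_simps)
    then show ?case using elim unfolding L_def[symmetric] by linarith
  qed
qed

lemma tendsto_zero: "(u \<longlongrightarrow> 0) at_top"
proof -
  define q where "q = (1 + \<bar>\<sigma>\<bar> / - \<mu>) / 2"
  have q: "0 < q" "q < 1"
    using damped \<mu>_neg by (auto simp: q_def divide_simps)
  define K where "K = a / c + N + 1"
  have "K > 0" using a_pos c_pos N_nonneg by (simp add: K_def add_nonneg_pos)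
  have bound: "eventually (\<lambda>t. \<bar>u t\<bar> \<le> q ^ n * K) at_top" for n
  proof (induction n)
    case 0
    show ?case
      using eventually_gt_at_top[of 0]
    proof eventually_elim
      case (elim t)
      have "0 < a / c" using a_pos c_pos by simp
      then show ?case
        using above_lower_barrier[OF elim] u_le[of t] elim N_nonneg by (auto simp: K_def)
    qed
  next
    case (Suc n)
    then show ?case
      using eventually_bound_contracts[of "q ^ n * K"] q \<open>K > 0\<close>
      unfolding q_def[symmetric] by (simp add: mult.assoc)
  qed
  show ?thesis
  proof (rule tendstoI)
    fix e :: real assume "e > 0"
    have "(\<lambda>n. q ^ n * K) \<longlonglongrightarrow> 0"
      using q by (intro tendsto_mult_left_zero LIMSEQ_power_zero) simp
    then have "eventually (\<lambda>n. q ^ n * K < e) sequentially"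
      using \<open>e > 0\<close> by (rule order_tendstoD)
    then obtain n where "q ^ n * K < e" by (auto simp: eventually_sequentially)
    with bound[of n] show "eventually (\<lambda>t. dist (u t) 0 < e) at_top"
      by (auto elim: eventually_mono)
  qed
qed

end

theorem theorem3p1:
  fixes a c \<mu> \<sigma> M0 N0 N \<tau> :: real
    and \<phi> u :: "real \<Rightarrow> real"
  assumes "a > 0" and "c > 0"
    and "(\<mu>, \<sigma>) \<in> Sigma_Delta"
    and "M0 = - (a / c)"
    and "N0 = (a * \<sigma>) / (c * \<mu>)"
    and "\<tau> = a + c * N"
    and "\<sigma> > 0 \<Longrightarrow> N \<ge> 0 \<and> (\<forall>t\<in>{-\<tau>..0}. \<phi> t \<in> {M0..N}) \<and> history_continuous \<tau> \<phi>"
    and "\<sigma> \<le> 0 \<Longrightarrow> N = max (\<phi> 0) N0 \<and> (\<forall>t\<in>{-\<tau>..0}. \<phi> t \<ge> M0) \<and> history_continuous \<tau> \<phi>"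
    and "sdde_solution a c \<mu> \<sigma> \<phi> u"
  shows "(\<forall>t>0. u t \<in> {M0<..N}) \<and>
         (\<not> rests_at a c \<mu> \<sigma> \<phi> N \<longrightarrow> (\<forall>t>0. u t \<in> {M0<..<N})) \<and>
         (u \<longlongrightarrow> 0) at_top"
proof -
  have damped: "\<bar>\<sigma>\<bar> < - \<mu>" using assms(3) by (simp add: Sigma_Delta_def)
  have "0 \<le> N0" if "\<sigma> \<le> 0"
    using that damped assms(1,2) unfolding assms(5)
    by (intro divide_nonpos_nonpos) (auto simp: mult_nonneg_nonpos)
  then have N: "0 \<le> N" using assms(7,8) by (cases "\<sigma> > 0") auto
  then have \<tau>: "\<tau> \<ge> 0" using assms(1,2,6) by simp
  interpret admissible_solution a c \<mu> \<sigma> N \<phi> u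
  proof
    show "history_continuous (a + c * N) \<phi>"
      using assms(6-8) by (cases "\<sigma> > 0") auto
    show "\<phi> 0 \<le> N"
      using assms(7,8) \<tau> by (cases "\<sigma> > 0") auto
    show "- (a / c) \<le> \<phi> t" if "- (a + c * N) \<le> t" "t \<le> 0" for t
      using assms(4,6-8) that by (cases "\<sigma> > 0") auto
    show "\<phi> t \<le> N" if "- (a + c * N) \<le> t" "t \<le> 0" "\<sigma> > 0" for t
      using assms(6,7) that by auto
    show "(a * \<sigma>) / (c * \<mu>) \<le> N" if "\<sigma> \<le> 0"
      using assms(5,8) that by simp
  qed (use assms damped N in auto)
  show ?thesis
    using above_lower_barrier u_le rests_at_if_attained tendsto_zero assms(4)
    by (auto simp: less_le)
qed

end
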